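(* Let $T$ be a balanced tree with characteristic tuple $C_T = (c_1, c_2, \ldots, c_l)$. Define a sequence of polynomials $Q_0(x), Q_1(x), \ldots, Q_{l+1}(x)$ by $$Q_0(x) = 1,\qquad Q_1(x) = x,\qquad Q_{j+2}(x) = x\, Q_{j+1}(x) - c_{l-j}\, Q_j(x)\quad \text{for all } 0 \le j \le l-1 .$$ Then $$P_x(T) = \prod_{j = 1}^{l+1} Q_j(x)^{\,n_{l+1-j}-n_{l-j}} .$$
   Context: For a finite simple graph $G$ with adjacency matrix $A(G)$, $P_x(G)=\det(xI-A(G))$ is the characteristic polynomial. A balanced tree is an unweighted rooted tree in which all vertices of the same level have equal degree. Its levels are numbered $0,\dots,l$, where level $0$ contains only the root and level $l$ contains the leaves. The characteristic tuple of a balanced tree $T$ is the tuple of positive integers $C_T=(c_1,\dots,c_l)$, where $c_j$ is the number of children of each vertex in level $j-1$, for $1\le j\le l$ (this determines $T$ up to isomorphism). The number of vertices in level $j$ is denoted $n_j$, so that $n_0=1$ and $n_j=n_{j-1}c_j$ for $1\le j\le l$; by convention $n_{-1}=0$. *)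

theory Defs
  imports
    "Graph_Theory.Digraph_Component"
    "Graph_Theory.Pair_Digraph"
    "Jordan_Normal_Form.Char_Poly"
begin

text \<open>
  A finite simple graph is a \<open>pair_graph\<close>: a finite, symmetric, loop-free digraph whose arcs are
  pairs of vertices, an undirected edge being the two opposite arcs. Since these two arcs already
  form a directed cycle of length 2, \<^const>\<open>tree\<close> does not describe undirected trees; acyclicity
  here excludes the cycles of length at least 3.
\<close>

definition undirected_tree :: "'a pair_pre_digraph \<Rightarrow> bool" where
  "undirected_tree T \<longleftrightarrow>
     pair_graph T \<and> connected (with_proj T) \<and>
     (\<nexists>p. pre_digraph.cycle (with_proj T) p \<and> 3 \<le> length p)"

definition level :: "'a pair_pre_digraph \<Rightarrow> 'a \<Rightarrow> 'a \<Rightarrow> nat" where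
  "level T r v = (LEAST n. \<exists>p. pre_digraph.awalk (with_proj T) r p v \<and> length p = n)"

definition height :: "'a pair_pre_digraph \<Rightarrow> 'a \<Rightarrow> nat" where
  "height T r = Max (level T r ` pverts T)"

definition children :: "'a pair_pre_digraph \<Rightarrow> 'a \<Rightarrow> 'a \<Rightarrow> 'a set" where
  "children T r v = {w. (v, w) \<in> parcs T \<and> level T r w = Suc (level T r v)}"

text \<open>
  In a symmetric digraph without parallel arcs, \<^const>\<open>out_degree\<close> is the degree of the
  undirected graph.
\<close>

definition balanced_tree :: "'a pair_pre_digraph \<Rightarrow> 'a \<Rightarrow> bool" where
  "balanced_tree T r \<longleftrightarrow>
     undirected_tree T \<and> r \<in> pverts T \<and>
     (\<forall>u\<in>pverts T. \<forall>v\<in>pverts T. level T r u = level T r v \<longrightarrow>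
        out_degree (with_proj T) u = out_degree (with_proj T) v)"

text \<open>
  Lists are indexed from 0, so \<open>C ! j\<close> is \<open>c\<^sub>j\<^sub>+\<^sub>1\<close>. Every level up to the height is
  inhabited, so \<open>C\<close> is uniquely determined, and its entries are positive.
\<close>

definition is_characteristic_tuple :: "'a pair_pre_digraph \<Rightarrow> 'a \<Rightarrow> nat list \<Rightarrow> bool" where
  "is_characteristic_tuple T r C \<longleftrightarrow>
     length C = height T r \<and>
     (\<forall>j<length C. \<forall>v\<in>pverts T. level T r v = j \<longrightarrow> card (children T r v) = C ! j)"

text \<open>
  The index is an integer, so that the convention \<open>n\<^sub>-\<^sub>1 = 0\<close> holds: no vertex has level -1.
  In a balanced tree the sizes are nondecreasing up to the height (\<open>c\<^sub>j \<ge> 1\<close>), so differences of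
  consecutive sizes are not truncated there.
\<close>

definition level_size :: "'a pair_pre_digraph \<Rightarrow> 'a \<Rightarrow> int \<Rightarrow> nat" where
  "level_size T r i = card {v \<in> pverts T. int (level T r v) = i}"

text \<open>The list \<open>vs\<close> is an enumeration of the vertices, which orders the rows and columns.\<close>

definition adjacency_matrix :: "'a pair_pre_digraph \<Rightarrow> 'a list \<Rightarrow> real mat" where
  "adjacency_matrix G vs =
     mat (length vs) (length vs) (\<lambda>(i, j). if (vs ! i, vs ! j) \<in> parcs G then 1 else 0)"

end

theory Submission
  imports Defs
begin

text \<open>
  Eliminating the leaves first, \<open>x I - A\<close> factors as \<open>L D L\<^sup>T\<close>, where \<open>D\<close> is diagonal with an entry
  \<open>d\<^sub>k\<close> depending only on the level \<open>k\<close>, and \<open>L\<close> is unipotent with entry \<open>-1 / d\<^sub>k\<^sub>+\<^sub>1\<close> for each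
  child at level \<open>k + 1\<close> of a vertex at level \<open>k\<close>. This works as soon as \<open>d\<^sub>k + c\<^sub>k\<^sub>+\<^sub>1 / d\<^sub>k\<^sub>+\<^sub>1 = x\<close>, which the
  recurrence for \<open>Q\<close> solves by \<open>d\<^sub>k = Q\<^sub>l\<^sub>-\<^sub>k\<^sub>+\<^sub>1(x) / Q\<^sub>l\<^sub>-\<^sub>k(x)\<close>. The determinant is then
  \<open>\<Prod>\<^sub>k d\<^sub>k ^ n\<^sub>k\<close>, which telescopes to the claimed product. Since the \<open>Q\<^sub>j\<close> are nonzero polynomials,
  this holds for all but finitely many real \<open>x\<close>, hence as an identity of polynomials.
\<close>

section \<open>Auxiliary facts on determinants, products and polynomials\<close>

text \<open>
  A permutation contributing to the determinant raises the grading \<open>f\<close> weakly everywhere, but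
  preserves its sum, so it is the identity. No sorting of the index set is needed.
\<close>

lemma det_graded_unitriangular:
  fixes A :: "'b :: comm_ring_1 mat" and f :: "nat \<Rightarrow> nat"
  assumes A: "A \<in> carrier_mat n n"
    and graded: "\<And>i j. i < n \<Longrightarrow> j < n \<Longrightarrow> i \<noteq> j \<Longrightarrow> A $$ (i, j) \<noteq> 0 \<Longrightarrow> f i < f j"
    and diag: "\<And>i. i < n \<Longrightarrow> A $$ (i, i) = 1"
  shows "det A = 1"
proof -
  let ?P = "{p. p permutes {0..<n}}"
  let ?t = "\<lambda>p. signof p * (\<Prod>i = 0..<n. A $$ (i, p i)) :: 'b"
  have off_id: "?t p = 0" if p: "p permutes {0..<n}" "p \<noteq> id" for p
  proof (rule ccontr)
    assume "?t p \<noteq> 0"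
    then have "(\<Prod>i = 0..<n. A $$ (i, p i)) \<noteq> 0" by auto
    then have nz: "A $$ (i, p i) \<noteq> 0" if "i < n" for i
      using that by (metis atLeastLessThan_iff finite_atLeastLessThan prod_zero zero_le)
    have lt: "p i < n" if "i < n" for i
      using permutes_in_image[OF p(1), of i] that by simp
    obtain k where k: "p k \<noteq> k" using p(2) by (auto simp: fun_eq_iff)
    then have "k < n" using p(1) by (metis atLeastLessThan_iff permutes_def zero_le)
    have mono: "f i \<le> f (p i)" if "i < n" for i
      using graded[OF that lt[OF that]] nz[OF that] by (cases "p i = i") auto
    have "(\<Sum>i = 0..<n. f i) < (\<Sum>i = 0..<n. f (p i))"
      using \<open>k < n\<close> k graded[OF \<open>k < n\<close> lt[OF \<open>k < n\<close>]] nz mono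
      by (intro sum_strict_mono_ex1) auto
    moreover have "(\<Sum>i = 0..<n. f (p i)) = (\<Sum>i = 0..<n. f i)"
      using sum.permute[OF p(1), of f] by (simp add: comp_def)
    ultimately show False by simp
  qed
  have "det A = (\<Sum>p\<in>?P. ?t p)" by (rule det_def'[OF A])
  also have "\<dots> = (\<Sum>p\<in>{id}. ?t p)"
    by (rule sum.mono_neutral_right) (use off_id in \<open>auto simp: finite_permutations permutes_id\<close>)
  also have "\<dots> = 1" using diag by simp
  finally show ?thesis .
qed

text \<open>\<open>q (l - k)\<close> is the denominator at \<open>k\<close> and the numerator at
  \<open>k + 1\<close>, so it survives with the difference of the two exponents. The condition
  \<open>n 0 = 0\<close> lets the first numerator \<open>q (l + 1)\<close> follow the same
  pattern.\<close>

lemma prod_consecutive_quotients: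
  fixes q :: "nat \<Rightarrow> 'b :: field" and n :: "nat \<Rightarrow> nat"
  assumes "q 0 = 1" and "\<And>k. k \<le> l + 1 \<Longrightarrow> q k \<noteq> 0"
    and "n 0 = 0" and "\<And>k. k \<le> l \<Longrightarrow> n k \<le> n (Suc k)"
  shows "(\<Prod>k\<le>l. (q (l - k + 1) / q (l - k)) ^ n (Suc k)) =
    (\<Prod>j = 1..l + 1. q j ^ (n (l + 2 - j) - n (l + 1 - j)))"
proof -
  \<comment> \<open>The partial product leaves one denominator uncancelled. It is moved to the left
    and equals 1 at \<open>m = l\<close>, being a power of \<open>q 0\<close>.\<close>
  have "(\<Prod>k\<le>m. (q (l - k + 1) / q (l - k)) ^ n (Suc k)) * q (l - m) ^ n (Suc m) =
    (\<Prod>k\<le>m. q (l - k + 1) ^ (n (Suc k) - n k))" if "m \<le> l" for m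
    using that
  proof (induction m)
    case 0
    then show ?case using assms(2)[of l] assms(3) by (simp add: power_divide)
  next
    case (Suc m)
    have nz: "q (l - Suc m) \<noteq> 0" using assms(2) by auto
    have le: "n (Suc m) \<le> n (Suc (Suc m))" using assms(4) Suc.prems by simp
    have idx: "l - Suc m + 1 = l - m" using Suc.prems by simp
    have "(\<Prod>k\<le>Suc m. (q (l - k + 1) / q (l - k)) ^ n (Suc k)) * q (l - Suc m) ^ n (Suc (Suc m))
      = (\<Prod>k\<le>m. (q (l - k + 1) / q (l - k)) ^ n (Suc k)) * q (l - m) ^ n (Suc (Suc m))"
      using nz idx by (simp add: power_divide)
    also have "q (l - m) ^ n (Suc (Suc m)) =
        q (l - m) ^ n (Suc m) * q (l - m) ^ (n (Suc (Suc m)) - n (Suc m))"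
      using le by (simp flip: power_add)
    also have "(\<Prod>k\<le>m. (q (l - k + 1) / q (l - k)) ^ n (Suc k)) * \<dots> =
        (\<Prod>k\<le>m. q (l - k + 1) ^ (n (Suc k) - n k)) *
        q (l - m) ^ (n (Suc (Suc m)) - n (Suc m))"
      using Suc.IH Suc.prems by (simp only: mult.assoc[symmetric])
    finally show ?case by (simp only: prod.atMost_Suc idx)
  qed
  from this[of l] have "(\<Prod>k\<le>l. (q (l - k + 1) / q (l - k)) ^ n (Suc k)) =
    (\<Prod>k\<le>l. q (l - k + 1) ^ (n (Suc k) - n k))"
    using assms(1) by simp
  also have "\<dots> = (\<Prod>j = 1..l + 1. q j ^ (n (l + 2 - j) - n (l + 1 - j)))"
    by (rule prod.reindex_bij_witness[of _ "\<lambda>j. l + 1 - j" "\<lambda>k. l + 1 - k"])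
       (auto simp: Suc_diff_le)
  finally show ?thesis .
qed

lemma poly_eqI_cofinite:
  fixes p q :: "'b :: {idom, ring_char_0} poly"
  assumes "finite {x. poly p x \<noteq> poly q x}"
  shows "p = q"
proof (rule ccontr)
  assume "p \<noteq> q"
  then have "finite {x. poly (p - q) x = 0}" by (intro poly_roots_finite) simp
  then have "finite ({x. poly p x \<noteq> poly q x} \<union> {x. poly (p - q) x = 0})"
    using assms by simp
  moreover have "UNIV \<subseteq> {x. poly p x \<noteq> poly q x} \<union> {x. poly (p - q) x = 0}" by auto
  ultimately show False using infinite_UNIV_char_0 finite_subset by blast
qed

text \<open>The leading term of \<open>Q (j + 2)\<close> comes from
  \<open>[:0, 1:] * Q (j + 1)\<close> alone. Carrying exact degrees through the induction rules out
  cancellation to zero.\<close>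

lemma degree_three_term_recurrence:
  fixes Q :: "nat \<Rightarrow> 'b :: idom poly"
  assumes "Q 0 = 1" and "Q 1 = [:0, 1:]"
    and rec: "\<And>j. j < l \<Longrightarrow> Q (j + 2) = [:0, 1:] * Q (j + 1) - Polynomial.smult (c j) (Q j)"
    and "j \<le> l + 1"
  shows "degree (Q j) = j \<and> Q j \<noteq> 0"
  using \<open>j \<le> l + 1\<close>
proof (induction j rule: less_induct)
  case (less j)
  consider "j = 0" | "j = 1" | i where "j = i + 2"
    by (metis One_nat_def Suc_1 add.commute add_2_eq_Suc not0_implies_Suc)
  then show ?case
  proof cases
    case 3
    then have IH: "degree (Q (i + 1)) = i + 1" "Q (i + 1) \<noteq> 0" "degree (Q i) = i"
      using less.IH[of "i + 1"] less.IH[of i] less.prems by auto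
    then have "degree ([:0, 1:] * Q (i + 1)) = i + 2"
      by (subst degree_mult_eq) auto
    moreover have "degree (Polynomial.smult (c i) (Q i)) < i + 2"
      using degree_smult_le[of "c i" "Q i"] IH by simp
    ultimately have "degree (Q j) = j"
      using rec[of i] 3 less.prems degree_add_eq_left[of "- Polynomial.smult (c i) (Q i)"]
      by (simp del: mult_pCons_left)
    then show ?thesis using 3 by auto
  qed (use assms in auto)
qed

section \<open>Levels, parents and children in a rooted tree\<close>

locale rooted_tree = pair_graph T for T :: "'a pair_pre_digraph" +
  fixes r :: 'a
  assumes root: "r \<in> pverts T"
    and tree_connected: "connected (with_proj T)"
    and acyclic: "cycle p \<Longrightarrow> length p < 3"
begin

abbreviation "lev \<equiv> level T r"

lemma arc_sym: "(u, v) \<in> parcs T \<Longrightarrow> (v, u) \<in> parcs T"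
  using pair_sym_arcs by (auto simp: symmetric_def sym_def)

lemma arc_verts: "(u, v) \<in> parcs T \<Longrightarrow> u \<in> pverts T" "(u, v) \<in> parcs T \<Longrightarrow> v \<in> pverts T"
  using arc_fst_in_verts arc_snd_in_verts by fastforce+

lemma shortest_walk:
  assumes "v \<in> pverts T"
  obtains p where "awalk r p v" "length p = lev v"
proof -
  obtain p where "awalk r p v"
    using tree_connected root assms reachable_mk_symmetric_eq[OF sym_arcs, of r v]
    unfolding connected_def strongly_connected_def by (auto simp: reachable_awalk)
  then have "\<exists>n. \<exists>p. awalk r p v \<and> length p = n" by blast
  from LeastI_ex[OF this] show ?thesis using that unfolding level_def by blast
qed

lemma level_le_length: "awalk r p v \<Longrightarrow> lev v \<le> length p"
  unfolding level_def by (rule Least_le) blast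

lemma level_arc_le:
  assumes "(u, v) \<in> parcs T"
  shows "lev v \<le> Suc (lev u)"
proof -
  obtain p where p: "awalk r p u" "length p = lev u"
    using shortest_walk arc_verts assms by blast
  then have "awalk r (p @ [(u, v)]) v"
    using assms by (auto simp: awalk_simps arc_verts)
  from level_le_length[OF this] p show ?thesis by simp
qed

lemma level_root: "lev r = 0"
  using level_le_length[of "[]" r] root by (simp add: awalk_Nil_iff)

lemma level_0_iff:
  assumes "v \<in> pverts T"
  shows "lev v = 0 \<longleftrightarrow> v = r"
proof
  assume "lev v = 0"
  obtain p where "awalk r p v" "length p = lev v" using shortest_walk assms by blast
  with \<open>lev v = 0\<close> show "v = r" by (simp add: awalk_Nil_iff)
qed (simp add: level_root)

text \<open>The last arc of a shortest walk starts at a parent: its source lies on a lower level,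
  and one arc raises the level by at most one.\<close>

lemma parent_exists:
  assumes "v \<in> pverts T" "v \<noteq> r"
  obtains u where "(u, v) \<in> parcs T" "lev v = Suc (lev u)"
proof -
  obtain p where p: "awalk r p v" "length p = lev v" using shortest_walk assms by blast
  have "p \<noteq> []" using p assms level_0_iff[of v] by auto
  then obtain q e where q: "p = q @ [e]" by (metis rev_exhaust)
  then have "awalk r q (fst e)" "e \<in> parcs T" "snd e = v"
    using p by (auto simp: awalk_simps)
  then have "(fst e, v) \<in> parcs T" "lev (fst e) \<le> length q"
    using level_le_length by auto
  then show ?thesis using that[of "fst e"] level_arc_le[of "fst e" v] p q by simp
qed

text \<open>Stated on arcs, so that it passes to any walk using a subset of them. The empty walk
  satisfies it vacuously, even at \<open>w\<close>.\<close>

definition avoids :: "'a \<Rightarrow> ('a \<times> 'a) list \<Rightarrow> bool" where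
  "avoids w p \<longleftrightarrow> (\<forall>e\<in>set p. fst e \<noteq> w \<and> snd e \<noteq> w)"

text \<open>Going from \<open>u\<close> to the root through parents, every later vertex has level
  less than \<open>lev w\<close>, so none is \<open>w\<close>.\<close>

lemma avoiding_walks:
  assumes "u \<in> pverts T" "u \<noteq> w" "lev u \<le> lev w"
  shows "\<exists>p q. awalk u p r \<and> avoids w p \<and> awalk r q u \<and> avoids w q"
  using assms
proof (induction "lev u" arbitrary: u)
  case 0
  then have "u = r" by (metis level_0_iff)
  then have "awalk u [] r \<and> avoids w [] \<and> awalk r [] u \<and> avoids w []"
    using root by (simp add: awalk_Nil_iff avoids_def)
  then show ?case by blast
next
  case (Suc n)
  then have "u \<noteq> r" using level_0_iff[of u] by auto
  then obtain t where t: "(t, u) \<in> parcs T" "lev u = Suc (lev t)"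
    using parent_exists Suc.prems by blast
  then have "t \<noteq> w" using Suc.prems by auto
  then obtain p q where pq: "awalk t p r" "avoids w p" "awalk r q t" "avoids w q"
    using Suc.hyps(1)[of t] Suc.hyps(2) Suc.prems t arc_verts by force
  then have "awalk u ((u, t) # p) r" "awalk r (q @ [(t, u)]) u"
    using t arc_sym arc_verts by (auto simp: awalk_simps)
  moreover have "avoids w ((u, t) # p)" "avoids w (q @ [(t, u)])"
    using pq Suc.prems \<open>t \<noteq> w\<close> by (auto simp: avoids_def)
  ultimately show ?case by blast
qed

text \<open>Walks from the root to two such neighbours avoid \<open>w\<close>, hence close up to a cycle through \<open>w\<close>.\<close>

lemma lower_neighbour_unique:
  assumes "(u, w) \<in> parcs T" "(v, w) \<in> parcs T" "lev u \<le> lev w" "lev v \<le> lev w"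
  shows "u = v"
proof (rule ccontr)
  assume "u \<noteq> v"
  have ne: "u \<noteq> w" "v \<noteq> w" using pair_no_loops assms by fastforce+
  obtain p where p: "awalk u p r" "avoids w p"
    using avoiding_walks[of u w] arc_verts assms ne by blast
  obtain q where q: "awalk r q v" "avoids w q"
    using avoiding_walks[of v w] arc_verts assms ne by blast
  define s where "s = awalk_to_apath (p @ q)"
  have walk: "awalk u (p @ q) v" using p q by auto
  have s: "apath u s v" unfolding s_def by (rule apath_awalk_to_apath[OF walk])
  have "set s \<subseteq> set (p @ q)" unfolding s_def by (rule awalk_to_apath_subset[OF walk])
  then have "avoids w s" using p q by (auto simp: avoids_def)
  moreover have "s \<noteq> []" using s \<open>u \<noteq> v\<close> by (auto simp: apath_Nil_iff)
  ultimately have w: "w \<notin> set (awalk_verts u s)"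
    by (auto simp: awalk_verts_conv avoids_def)
  have walk': "awalk u (s @ [(v, w)]) w"
    using s assms arc_verts by (auto simp: awalk_simps apath_def)
  then have "awalk w ((w, u) # s @ [(v, w)]) w"
    using assms(1) arc_sym arc_verts by (simp add: awalk_Cons_iff del: awalk_append_iff)
  moreover have "tl (awalk_verts w ((w, u) # s @ [(v, w)])) = awalk_verts u s @ [w]"
    using awalk_verts_append[OF walk'] by simp
  ultimately have "cycle ((w, u) # s @ [(v, w)])"
    unfolding cycle_def using s w by (auto simp: apath_def)
  \<comment> \<open>Since \<open>s\<close> is nonempty, this cycle has at least three arcs.\<close>
  from acyclic[OF this] \<open>s \<noteq> []\<close> show False by (cases s) auto
qed

text \<open>Were the levels equal, \<open>u\<close> and the parent of \<open>v\<close> would be two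
  distinct neighbours of \<open>v\<close> on levels at most \<open>lev v\<close>.\<close>

lemma level_arc_neq:
  assumes "(u, v) \<in> parcs T"
  shows "lev u \<noteq> lev v"
proof
  assume eq: "lev u = lev v"
  have "u \<noteq> v" using pair_no_loops assms by fastforce
  then have "v \<noteq> r" using eq level_0_iff arc_verts[OF assms] by metis
  then obtain t where "(t, v) \<in> parcs T" "lev v = Suc (lev t)"
    using parent_exists arc_verts assms by blast
  then show False using lower_neighbour_unique[of u v t] assms eq by auto
qed

lemma arc_iff_children:
  "(u, v) \<in> parcs T \<longleftrightarrow> v \<in> children T r u \<or> u \<in> children T r v"
  using level_arc_le[of u v] level_arc_le[of v u] level_arc_neq[of u v] arc_sym
  by (auto simp: children_def)

lemma children_disjoint: "w \<in> children T r u \<Longrightarrow> w \<in> children T r v \<Longrightarrow> u = v"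
  using lower_neighbour_unique[of u w v] by (auto simp: children_def)

lemma level_children: "w \<in> children T r v \<Longrightarrow> lev w = Suc (lev v)"
  by (simp add: children_def)

lemma children_subset: "children T r v \<subseteq> pverts T"
  by (auto simp: children_def arc_verts)

lemma finite_children: "finite (children T r v)"
  using children_subset pair_finite_verts finite_subset by blast

lemma level_le_height: "v \<in> pverts T \<Longrightarrow> lev v \<le> height T r"
  unfolding height_def using pair_finite_verts by auto

lemma children_top_level:
  assumes "lev v = height T r"
  shows "children T r v = {}"
  using assms level_le_height level_children children_subset by fastforce

text \<open>The height is attained by finiteness, and passing to parents reaches each lower
  level.\<close>

lemma level_inhabited:
  assumes "k \<le> height T r"
  obtains v where "v \<in> pverts T" "lev v = k"
proof -
  have "\<exists>v \<in> pverts T. lev v = k"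
    using assms
  proof (induction k rule: inc_induct)
    case base
    have "height T r \<in> lev ` pverts T"
      unfolding height_def using pair_finite_verts root by (intro Max_in) auto
    then show ?case by auto
  next
    case (step k)
    then obtain v where v: "v \<in> pverts T" "lev v = Suc k" by blast
    then have "v \<noteq> r" using level_root by auto
    then obtain u where "(u, v) \<in> parcs T" "lev v = Suc (lev u)"
      using parent_exists v by blast
    then show ?case using arc_verts v by auto
  qed
  then show ?thesis using that by blast
qed

section \<open>The factorization of \<open>x I - A\<close> and its determinant\<close>

text \<open>An entry of \<open>L\<close>: at a child \<open>w\<close> of \<open>u\<close>,
  multiplying by the pivot \<open>d (lev w)\<close> gives -1, the matching entry of
  \<open>-A\<close>.\<close>

definition lower_factor :: "(nat \<Rightarrow> real) \<Rightarrow> 'a \<Rightarrow> 'a \<Rightarrow> real" where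
  "lower_factor d u w =
     (if u = w then 1 else if w \<in> children T r u then - 1 / d (lev w) else 0)"

text \<open>
  This is \<open>x I - A = L D L\<^sup>T\<close>, entry by entry. Distinct vertices have no common child,
  so off the diagonal only \<open>w = u\<close> and \<open>w = v\<close> contribute; on it, each child adds \<open>1 / d\<close>.
\<close>

lemma LDL_entry:
  assumes d0: "\<And>k. d k \<noteq> 0" and uv: "u \<in> pverts T" "v \<in> pverts T"
    and rec: "\<And>u. u \<in> pverts T \<Longrightarrow>
      d (lev u) + real (card (children T r u)) / d (Suc (lev u)) = x"
  shows "(\<Sum>w\<in>pverts T. lower_factor d u w * d (lev w) * lower_factor d v w) =
    (if u = v then x else 0) - (if (u, v) \<in> parcs T then 1 else 0)"
proof -
  let ?ch = "children T r" and ?\<delta> = "\<lambda>P. if P then 1 else 0 :: real"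
  have irr: "a \<notin> ?ch a" for a using level_children by fastforce
  have split: "lower_factor d u w * d (lev w) * lower_factor d v w =
    (if w = u then ?\<delta> (u = v) * d (lev u) - ?\<delta> (u \<in> ?ch v) else 0) +
    (if w = v then - ?\<delta> (v \<in> ?ch u) else 0) +
    (if w \<in> ?ch u then ?\<delta> (u = v) / d (Suc (lev u)) else 0)" for w
  proof (cases "u = v")
    case True
    then show ?thesis
      using irr[of u] d0[of "lev w"] level_children[of w u] by (simp add: lower_factor_def)
  next
    case False
    then have "w \<notin> ?ch u \<or> w \<notin> ?ch v" using children_disjoint by blast
    then show ?thesis using False irr[of u] irr[of v] d0[of "lev w"]
      by (auto simp: lower_factor_def)
  qed
  have "(\<Sum>w\<in>pverts T. if w \<in> ?ch u then ?\<delta> (u = v) / d (Suc (lev u)) else 0) =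
      (\<Sum>w\<in>?ch u. ?\<delta> (u = v) / d (Suc (lev u)))"
    using pair_finite_verts children_subset[of u]
    by (simp add: sum.If_cases Int_absorb1)
  then have "(\<Sum>w\<in>pverts T. lower_factor d u w * d (lev w) * lower_factor d v w) =
      ?\<delta> (u = v) * d (lev u) - ?\<delta> (u \<in> ?ch v) - ?\<delta> (v \<in> ?ch u) +
      real (card (?ch u)) * (?\<delta> (u = v) / d (Suc (lev u)))"
    unfolding split using uv pair_finite_verts by (simp add: sum.distrib)
  also have "\<dots> = (if u = v then x else 0) - (if (u, v) \<in> parcs T then 1 else 0)"
  proof (cases "u = v")
    case True
    then show ?thesis using rec[OF uv(1)] irr[of u] arc_iff_children[of u u] by simp
  next
    case False
    \<comment> \<open>Only one end of an edge is the parent, so the two indicators never subtract 1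
      twice.\<close>
    have "\<not> (v \<in> ?ch u \<and> u \<in> ?ch v)"
      using level_children[of u v] level_children[of v u] by linarith
    then show ?thesis using False arc_iff_children[of u v] by auto
  qed
  finally show ?thesis .
qed

lemma poly_char_poly_adjacency:
  assumes d0: "\<And>k. d k \<noteq> 0"
    and rec: "\<And>u. u \<in> pverts T \<Longrightarrow>
      d (lev u) + real (card (children T r u)) / d (Suc (lev u)) = x"
    and vs: "distinct vs" "set vs = pverts T"
  shows "poly (char_poly (adjacency_matrix T vs)) x = (\<Prod>v\<in>pverts T. d (lev v))"
proof -
  let ?n = "length vs"
  define L where "L = mat ?n ?n (\<lambda>(i, j). lower_factor d (vs ! i) (vs ! j))"
  define D where "D = mat ?n ?n (\<lambda>(i, j). if i = j then d (lev (vs ! i)) else 0)"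
  have A: "adjacency_matrix T vs \<in> carrier_mat ?n ?n"
    and L: "L \<in> carrier_mat ?n ?n" and D: "D \<in> carrier_mat ?n ?n"
    by (auto simp: adjacency_matrix_def L_def D_def)
  have bij: "bij_betw ((!) vs) {0..<?n} (pverts T)"
    using bij_betw_nth[OF vs(1), of "{0..<?n}" "pverts T"] vs by (simp add: lessThan_atLeast0)
  \<comment> \<open>A nonzero off-diagonal entry of \<open>L\<close> leads from a parent to a child,
    so the level serves as the grading.\<close>
  have detL: "det L = 1"
    by (rule det_graded_unitriangular[OF L, of "\<lambda>i. lev (vs ! i)"])
       (auto simp: L_def lower_factor_def level_children nth_eq_iff_index_eq[OF vs(1)]
             split: if_splits)
  have "det D = prod_list (diag_mat D)"
    by (rule det_upper_triangular[OF _ D]) (auto simp: D_def upper_triangular_def)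
  also have "\<dots> = (\<Prod>i = 0..<?n. d (lev (vs ! i)))"
    by (simp add: prod_list_diag_prod D_def)
  also have "\<dots> = (\<Prod>v\<in>pverts T. d (lev v))"
    by (rule prod.reindex_bij_betw[OF bij])
  finally have detD: "det D = (\<Prod>v\<in>pverts T. d (lev v))" .
  \<comment> \<open>\<open>char_matrix\<close> is \<open>A - x I\<close>, whence the sign.\<close>
  have "- char_matrix (adjacency_matrix T vs) x = L * D * transpose_mat L"
  proof (rule eq_matI)
    fix i j assume "i < dim_row (L * D * transpose_mat L)" "j < dim_col (L * D * transpose_mat L)"
    then have ij: "i < ?n" "j < ?n" using L by auto
    have LD: "(L * D) $$ (i, k) = lower_factor d (vs ! i) (vs ! k) * d (lev (vs ! k))"
      if "k < ?n" for k
      using ij that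
      by (simp add: L_def D_def scalar_prod_def if_distrib[where f = "(*) _"] cong: if_cong)
    have "(M * transpose_mat L) $$ (i, j) = (\<Sum>k = 0..<?n. M $$ (i, k) * L $$ (j, k))"
      if "M \<in> carrier_mat ?n ?n" for M
      using ij L that by (simp add: scalar_prod_def)
    then have "(L * D * transpose_mat L) $$ (i, j) =
        (\<Sum>k = 0..<?n. (L * D) $$ (i, k) * L $$ (j, k))"
      using L D by (meson mult_carrier_mat)
    also have "\<dots> = (\<Sum>k = 0..<?n. lower_factor d (vs ! i) (vs ! k) * d (lev (vs ! k)) *
        lower_factor d (vs ! j) (vs ! k))"
      by (rule sum.cong) (use LD ij in \<open>auto simp: L_def\<close>)
    also have "\<dots> = (\<Sum>w\<in>pverts T.
        lower_factor d (vs ! i) w * d (lev w) * lower_factor d (vs ! j) w)"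
      by (rule sum.reindex_bij_betw[OF bij])
    also have "\<dots> = (if vs ! i = vs ! j then x else 0) -
        (if (vs ! i, vs ! j) \<in> parcs T then 1 else 0)"
      by (rule LDL_entry[OF d0 _ _ rec]) (use ij vs in auto)
    also have "\<dots> = (- char_matrix (adjacency_matrix T vs) x) $$ (i, j)"
      using ij vs by (simp add: char_matrix_def adjacency_matrix_def nth_eq_iff_index_eq)
    finally show "(- char_matrix (adjacency_matrix T vs) x) $$ (i, j) =
      (L * D * transpose_mat L) $$ (i, j)" ..
  qed (use L A in \<open>auto simp: char_matrix_def\<close>)
  then have "poly (char_poly (adjacency_matrix T vs)) x = det (L * D * transpose_mat L)"
    using char_poly_matrix[OF A] by simp
  also have "\<dots> = det L * det D * det L"
    using L D by (simp add: det_mult[of _ ?n] det_transpose[of _ ?n])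
  finally show ?thesis using detL detD by simp
qed

section \<open>Sizes of the levels\<close>

lemma prod_over_levels:
  "(\<Prod>v\<in>pverts T. d (lev v)) =
    (\<Prod>k\<le>height T r. (d k :: real) ^ level_size T r (int k))"
proof -
  have "lev ` pverts T \<subseteq> {..height T r}" using level_le_height by auto
  from prod.group[OF pair_finite_verts _ this, of "\<lambda>v. d (lev v)"]
  have "(\<Prod>v\<in>pverts T. d (lev v)) =
      (\<Prod>k\<le>height T r. \<Prod>v\<in>{v \<in> pverts T. lev v = k}. d (lev v))"
    by simp
  then show ?thesis by (simp add: level_size_def)
qed

text \<open>Level \<open>k + 1\<close> is inhabited, so some vertex of level \<open>k\<close> has a
  child, and by the tuple all of them do. Choosing one child for each is injective, as parents are
  unique. This makes the natural subtraction in the exponents exact.\<close>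

lemma level_size_mono:
  assumes C: "is_characteristic_tuple T r C" and k: "k < length C"
  shows "level_size T r (int k) \<le> level_size T r (int k + 1)"
proof -
  let ?V = "\<lambda>k. {v \<in> pverts T. lev v = k}"
  obtain w where w: "w \<in> pverts T" "lev w = Suc k"
    using level_inhabited[of "Suc k"] C k by (auto simp: is_characteristic_tuple_def)
  then have "w \<noteq> r" using level_root by auto
  then obtain u where u: "(u, w) \<in> parcs T" "lev w = Suc (lev u)"
    using parent_exists w by blast
  then have "w \<in> children T r u" by (simp add: children_def)
  then have "card (children T r u) \<noteq> 0" using finite_children[of u] by auto
  moreover have card_ch: "card (children T r v) = C ! k" if "v \<in> ?V k" for v
    using that C k by (auto simp: is_characteristic_tuple_def)
  moreover have "u \<in> ?V k" using u w arc_verts by auto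
  ultimately have "C ! k \<noteq> 0" by metis
  then have pos: "children T r v \<noteq> {}" if "v \<in> ?V k" for v
    using card_ch[OF that] by auto
  define g where "g = (\<lambda>v. SOME w. w \<in> children T r v)"
  have g: "g v \<in> children T r v" if "v \<in> ?V k" for v
    unfolding g_def using pos[OF that] by (simp add: some_in_eq)
  have "inj_on g (?V k)"
    by (rule inj_onI) (metis g children_disjoint)
  moreover have "g ` ?V k \<subseteq> ?V (Suc k)"
    using g children_subset level_children by fastforce
  ultimately have "card (?V k) \<le> card (?V (Suc k))"
    using pair_finite_verts by (intro card_inj_on_le) auto
  moreover have "{v \<in> pverts T. int (lev v) = int k + 1} = ?V (Suc k)" by auto
  ultimately show ?thesis by (simp add: level_size_def)
qed

end

section \<open>The pivots given by the recurrence, and the passage to polynomials\<close>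

theorem theorem3:
  fixes T :: "'a pair_pre_digraph" and r :: 'a and C :: "nat list" and l :: nat
    and vs :: "'a list" and Q :: "nat \<Rightarrow> real poly"
  assumes "balanced_tree T r"
    and "is_characteristic_tuple T r C" and "l = length C"
    and "distinct vs" and "set vs = pverts T"
    and "Q 0 = 1" and "Q 1 = [:0, 1:]"
    and "\<And>j. j < l \<Longrightarrow>
           Q (j + 2) = [:0, 1:] * Q (j + 1) - Polynomial.smult (real (C ! (l - j - 1))) (Q j)"
  shows "char_poly (adjacency_matrix T vs) =
    (\<Prod>j = 1..l + 1.
       Q j ^ (level_size T r (int l + 1 - int j) - level_size T r (int l - int j)))"
proof -
  interpret pair_graph T
    using assms(1) by (simp add: balanced_tree_def undirected_tree_def)
  interpret rooted_tree T r
    using assms(1) unfolding balanced_tree_def undirected_tree_def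
    by unfold_locales (auto simp: not_le)
  have height: "height T r = l"
    using assms(2,3) by (simp add: is_characteristic_tuple_def)
  \<comment> \<open>Shifted by one, so that \<open>n 0\<close> is the size of the empty level
    -1.\<close>
  define n where "n k = level_size T r (int k - 1)" for k
  have n_mono: "n k \<le> n (Suc k)" if "k \<le> l" for k
    using level_size_mono[OF assms(2), of "k - 1"] that assms(3)
    by (cases k) (auto simp: n_def level_size_def add.commute)
  have n_0: "n 0 = 0" by (simp add: n_def level_size_def)
  let ?R = "\<Prod>j = 1..l + 1.
    Q j ^ (level_size T r (int l + 1 - int j) - level_size T r (int l - int j))"
  have R: "?R = (\<Prod>j = 1..l + 1. Q j ^ (n (l + 2 - j) - n (l + 1 - j)))"
    by (rule prod.cong) (auto simp: n_def of_nat_diff algebra_simps)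
  have good: "poly (char_poly (adjacency_matrix T vs)) x = poly ?R x"
    if Q0: "\<And>j. j \<le> l + 1 \<Longrightarrow> poly (Q j) x \<noteq> 0" for x
  proof -
    define q where "q j = poly (Q j) x" for j
    \<comment> \<open>The value 1 beyond level \<open>l\<close> only keeps \<open>d\<close> nonzero:
      at a leaf it divides a child count of 0.\<close>
    define d where "d k = (if k \<le> l then q (l - k + 1) / q (l - k) else 1)" for k
    have rec: "d (lev u) + real (card (children T r u)) / d (Suc (lev u)) = x"
      if u: "u \<in> pverts T" for u
    proof (cases "lev u = l")
      case True
      then show ?thesis
        using children_top_level[of u] height assms(6,7) by (simp add: d_def q_def)
    next
      case False
      then have lt: "lev u < l" using level_le_height[OF u] height by simp
      \<comment> \<open>With this \<open>j\<close>, the two pivots are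
        \<open>q (j + 2) / q (j + 1)\<close> and \<open>q (j + 1) / q j\<close>, and the claim is
        the recurrence divided by \<open>q (j + 1)\<close>.\<close>
      define j where "j = l - Suc (lev u)"
      have j: "j < l" "l - j - 1 = lev u" "l - lev u = Suc j" using lt by (auto simp: j_def)
      have "card (children T r u) = C ! lev u"
        using assms(2,3) lt u by (auto simp: is_characteristic_tuple_def)
      moreover have "q (j + 2) = x * q (j + 1) - real (C ! lev u) * q j"
        using assms(8)[OF j(1)] j(2) by (simp add: q_def)
      moreover have "q (j + 1) \<noteq> 0" using Q0[of "j + 1"] j by (simp add: q_def)
      ultimately show ?thesis
        using lt j j_def by (simp add: d_def field_simps numeral_2_eq_2)
    qed
    have "d k \<noteq> 0" for k using Q0 by (simp add: d_def q_def)
    from poly_char_poly_adjacency[OF this rec assms(4,5)]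
    have "poly (char_poly (adjacency_matrix T vs)) x =
        (\<Prod>k\<le>l. d k ^ level_size T r (int k))"
      using prod_over_levels[of d] height by simp
    also have "\<dots> = (\<Prod>k\<le>l. (q (l - k + 1) / q (l - k)) ^ n (Suc k))"
      by (rule prod.cong) (auto simp: d_def n_def)
    also have "\<dots> = (\<Prod>j = 1..l + 1. q j ^ (n (l + 2 - j) - n (l + 1 - j)))"
      using assms(6) Q0 n_0 n_mono by (intro prod_consecutive_quotients) (auto simp: q_def)
    also have "\<dots> = poly ?R x"
      unfolding R by (simp add: poly_prod q_def)
    finally show ?thesis .
  qed
  \<comment> \<open>The excluded points are roots of finitely many nonzero polynomials.\<close>
  have "Q j \<noteq> 0" if "j \<le> l + 1" for j
    using degree_three_term_recurrence[OF assms(6,7,8)] that by blast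
  then have "finite (\<Union>j\<in>{..l + 1}. {x. poly (Q j) x = 0})"
    by (intro finite_UN_I) (auto intro: poly_roots_finite)
  moreover have "{x. poly (char_poly (adjacency_matrix T vs)) x \<noteq> poly ?R x} \<subseteq>
      (\<Union>j\<in>{..l + 1}. {x. poly (Q j) x = 0})"
    using good by auto
  ultimately show ?thesis
    by (intro poly_eqI_cofinite) (rule finite_subset)
qed

end
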